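(* Let $n\ge2$, $M\ge1$, $u_1,\dots,u_M\in[n-1]$ (repetitions allowed), and let $W=\frac1M\sum_{i=1}^M A^{(u_i)}$ have consensus rate $\rho$. Let $\eta\in(0,1)$, let $v_t$ be drawn uniformly from the multiset $\{u_1,\dots,u_M\}$ (i.e. $v_t=u_I$ with $I$ uniform on $[M]$), and let $W^{(t)}=(1-\eta)I+\eta A^{(v_t)}$ (the OD-EquiDyn weight matrix). Then $$\mathbb{E}\big[\|\Pi W^{(t)}x\|^2\big]\le\big(1-2\eta(1-\eta)(1-\rho)\big)\|\Pi x\|^2\qquad\text{for all }x\in\mathbb{R}^n .$$
   Context: Notation: $[m]=\{1,\dots,m\}$; $\|\cdot\|$ is the Euclidean norm; $\mathbf 1_n$ is the all-ones vector; $J=\frac1n\mathbf 1_n\mathbf 1_n^T$ and $\Pi=I-J$. The operation $i\bmod n$ returns the representative of $i$ modulo $n$ lying in $\{1,\dots,n\}$. Basis matrices: for $u\in[n-1]$, $A^{(u)}=[a^{(u)}_{ij}]\in\mathbb{R}^{n\times n}$ is defined by $a^{(u)}_{ij}=\frac{n-1}{n}$ if $i=(j+u)\bmod n$, $a^{(u)}_{ij}=\frac1n$ if $i=j$, and $a^{(u)}_{ij}=0$ otherwise. Consensus rate: the consensus rate of a fixed matrix $W$ is the minimum $\rho\ge0$ such that $\|\Pi Wx\|\le\rho\|\Pi x\|$ for all $x\in\mathbb{R}^n$. The expectation is over the random choice of $v_t$. *)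

theory Defs
  imports "HOL-Probability.Probability" "Berlekamp_Zassenhaus.Finite_Field"
begin

text \<open>
  Matrices of size n are indexed by the type \<open>'n mod_ring\<close> of integers modulo
  \<open>n = CARD('n)\<close>; the sort \<open>nontriv\<close> of \<open>'n\<close> says exactly that \<open>n \<ge> 2\<close>.
  The representatives 1, ..., n of the residue classes, with n standing for 0, give the usual
  indexing by 1, ..., n, under which addition in the type is addition followed by
  reduction modulo n to a value in 1, ..., n.
\<close>

type_synonym 'n sq_matrix = "real ^ 'n mod_ring ^ 'n mod_ring"

text \<open>
  The shift u is meant to lie in \<open>{1..CARD('n) - 1}\<close>, where the first two cases below
  are mutually exclusive.
\<close>

definition basis_matrix :: "nat \<Rightarrow> 'n::nontriv sq_matrix" where
  "basis_matrix u = (\<chi> i j.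
     if i = j + of_nat u then (real CARD('n) - 1) / real CARD('n)
     else if i = j then 1 / real CARD('n)
     else 0)"

definition avg_matrix :: "real ^ 'm ^ 'm::finite" where
  "avg_matrix = (\<chi> i j. 1 / real CARD('m))"

definition centering_matrix :: "real ^ 'm ^ 'm::finite" where
  "centering_matrix = mat 1 - avg_matrix"

text \<open>
  The least element exists if \<open>W *v 1\<close> is a multiple of the all-ones vector
  (in particular for averages of basis matrices); for other W no admissible bound exists
  and the value is unspecified.
\<close>

definition consensus_rate :: "real ^ 'm ^ 'm::finite \<Rightarrow> real" where
  "consensus_rate W = (LEAST \<rho>. 0 \<le> \<rho> \<and>
     (\<forall>x. norm (centering_matrix *v (W *v x)) \<le> \<rho> * norm (centering_matrix *v x)))"

definition od_equidyn_matrix :: "real \<Rightarrow> nat \<Rightarrow> 'n::nontriv sq_matrix" where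
  "od_equidyn_matrix \<eta> v = (1 - \<eta>) *\<^sub>R mat 1 + \<eta> *\<^sub>R basis_matrix v"

end

theory Submission
  imports Defs
begin

text \<open>
  The matrix \<open>A u\<close> is a convex combination of a cyclic shift and the identity, hence a
  contraction that commutes with the centering \<open>\<Pi>\<close>. With \<open>y = \<Pi> x\<close>, expanding the square gives
  \<open>\<parallel>(1 - \<eta>) y + \<eta> A y\<parallel>\<^sup>2 \<le> ((1 - \<eta>)\<^sup>2 + \<eta>\<^sup>2) \<parallel>y\<parallel>\<^sup>2 + 2 \<eta> (1 - \<eta>) (y \<bullet> A y)\<close>. Averaging over the
  shifts turns the last inner product into \<open>y \<bullet> W y\<close>, which is at most \<open>\<rho> \<parallel>y\<parallel>\<^sup>2\<close> by Cauchy-Schwarz.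
\<close>

lemma centering_matrix_component:
  fixes x :: "real ^ 'm::finite"
  shows "(centering_matrix *v x) $ i = x $ i - (\<Sum>j\<in>UNIV. x $ j) / real CARD('m)"
  unfolding centering_matrix_def matrix_vector_mult_diff_rdistrib
  by (simp add: avg_matrix_def matrix_vector_mult_def[of avg_matrix, unfolded avg_matrix_def]
      sum_divide_distrib)

text \<open>The permutation part of a basis matrix, kept as an operator on vectors rather than a
  matrix. Any finite index group will do, since only the invertibility of translation
  matters.\<close>

definition shift :: "'a::{finite, group_add} \<Rightarrow> (real, 'a) vec \<Rightarrow> (real, 'a) vec" where
  "shift k x = (\<chi> i. x $ (i - k))"

lemma sum_diff_right:
  fixes f :: "'a::{finite, group_add} \<Rightarrow> 'b::comm_monoid_add"
  shows "(\<Sum>i\<in>UNIV. f (i - k)) = (\<Sum>i\<in>UNIV. f i)"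
  by (rule sum.reindex_bij_witness[where i = "\<lambda>i. i + k" and j = "\<lambda>i. i - k"]) auto

lemma norm_shift: "norm (shift k x) = norm x"
  by (simp add: norm_vec_def L2_set_def shift_def sum_diff_right[where f = "\<lambda>i. (x $ i)\<^sup>2"])

text \<open>Translation permutes the coordinates, so it leaves their mean unchanged.\<close>

lemma centering_shift: "centering_matrix *v shift k x = shift k (centering_matrix *v x)"
  by (simp add: vec_eq_iff centering_matrix_component shift_def sum_diff_right)

text \<open>As \<open>0 < u < CARD('n)\<close>, the number \<open>u\<close> is its own canonical
  representative.\<close>

lemma of_nat_mod_ring_neq_0:
  assumes "u \<in> {1..CARD('n) - 1}"
  shows "(of_nat u :: 'n::nontriv mod_ring) \<noteq> 0"
proof -
  have "to_int_mod_ring (of_nat u :: 'n mod_ring) = int u"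
    using assms unfolding of_nat_of_int_mod_ring comp_apply
    by (intro to_int_mod_ring_of_int_mod_ring) auto
  then show ?thesis
    using assms by auto
qed

lemma basis_matrix_mult:
  fixes x :: "real ^ 'n::nontriv mod_ring"
  assumes "u \<in> {1..CARD('n) - 1}"
  shows "basis_matrix u *v x =
    ((real CARD('n) - 1) / real CARD('n)) *\<^sub>R shift (of_nat u) x + (1 / real CARD('n)) *\<^sub>R x"
proof (rule vec_eq_iff[THEN iffD2], rule allI)
  fix i :: "'n mod_ring"
  let ?c = "(real CARD('n) - 1) / real CARD('n)" and ?d = "1 / real CARD('n)"
  have neq: "(of_nat u :: 'n mod_ring) \<noteq> 0"
    using assms by (rule of_nat_mod_ring_neq_0)
  have "(basis_matrix u *v x) $ i =
    (\<Sum>j\<in>UNIV. (if i = j + of_nat u then ?c else if i = j then ?d else 0) * x $ j)"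
    by (simp add: basis_matrix_def matrix_vector_mult_def)
  \<comment> \<open>The nested conditional splits into two independent ones because
    \<open>neq\<close> rules out that both conditions hold for the same \<open>j\<close>.\<close>
  also have "\<dots> = (\<Sum>j\<in>UNIV. (if j = i - of_nat u then ?c * x $ j else 0)
      + (if j = i then ?d * x $ j else 0))"
    by (rule sum.cong) (use neq in \<open>auto simp: eq_diff_eq\<close>)
  also have "\<dots> = ?c * x $ (i - of_nat u) + ?d * x $ i"
    by (simp add: sum.distrib)
  finally show "(basis_matrix u *v x) $ i = (?c *\<^sub>R shift (of_nat u) x + ?d *\<^sub>R x) $ i"
    by (simp add: shift_def)
qed

lemma centering_basis_matrix:
  assumes "u \<in> {1..CARD('n) - 1}"
  shows "centering_matrix *v (basis_matrix u *v x) =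
    (basis_matrix u :: 'n::nontriv sq_matrix) *v (centering_matrix *v x)"
  by (simp add: basis_matrix_mult[OF assms] matrix_vector_right_distrib
      matrix_vector_mult_scaleR centering_shift)

text \<open>Triangle inequality: the two weights are nonnegative with sum 1, and the shift is an
  isometry.\<close>

lemma norm_basis_matrix_le:
  fixes x :: "real ^ 'n::nontriv mod_ring"
  assumes "u \<in> {1..CARD('n) - 1}"
  shows "norm (basis_matrix u *v x) \<le> norm x"
proof -
  have "norm (basis_matrix u *v x) \<le>
    (real CARD('n) - 1) / real CARD('n) * norm x + 1 / real CARD('n) * norm x"
    unfolding basis_matrix_mult[OF assms]
    by (rule norm_triangle_le) (use nontriv[where ?'a = 'n] in \<open>simp add: norm_shift\<close>)
  also have "\<dots> = norm x"
    by (simp add: field_simps)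
  finally show ?thesis .
qed

text \<open>\<open>LEAST\<close> over the reals is meaningful only if the minimum is attained. One
  admissible bound \<open>r\<close> makes the set of bounds nonempty, and the infimum of that set
  turns out to be admissible itself.\<close>

lemma consensus_rate_bound:
  fixes W :: "real ^ 'm ^ 'm::finite"
  assumes "0 \<le> r"
    and "\<And>x. norm (centering_matrix *v (W *v x)) \<le> r * norm (centering_matrix *v x)"
  shows "norm (centering_matrix *v (W *v x)) \<le> consensus_rate W * norm (centering_matrix *v x)"
proof -
  define S where "S = {r. 0 \<le> r \<and>
    (\<forall>x. norm (centering_matrix *v (W *v x)) \<le> r * norm (centering_matrix *v x))}"
  have "r \<in> S"
    using assms by (simp add: S_def)
  have "bdd_below S"
    by (auto simp: S_def)
  have "norm (centering_matrix *v (W *v x)) \<le> Inf S * norm (centering_matrix *v x)" for x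
  proof (cases "centering_matrix *v x = 0")
    \<comment> \<open>There is no quotient to compare with here, but the admissible \<open>r\<close>
      forces the left side to vanish.\<close>
    case True
    then show ?thesis
      using assms(2)[of x] by simp
  next
    case False
    \<comment> \<open>The quotient is a lower bound of \<open>S\<close>, hence at most its
      infimum.\<close>
    then have "norm (centering_matrix *v (W *v x)) / norm (centering_matrix *v x) \<le> Inf S"
      using \<open>r \<in> S\<close> by (intro cInf_greatest) (auto simp: S_def pos_divide_le_eq)
    with False show ?thesis
      by (simp add: pos_divide_le_eq)
  qed
  moreover have "0 \<le> Inf S"
    using \<open>r \<in> S\<close> by (intro cInf_greatest) (auto simp: S_def)
  ultimately have "consensus_rate W = Inf S"
    unfolding consensus_rate_def
    by (intro Least_equality) (auto intro!: cInf_lower \<open>bdd_below S\<close> simp: S_def)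
  with \<open>\<And>x. norm (centering_matrix *v (W *v x)) \<le> Inf S * norm (centering_matrix *v x)\<close>
  show ?thesis
    by simp
qed

lemma sum_matrix_vector_mult:
  fixes f :: "'i \<Rightarrow> real ^ 'm ^ 'k::finite"
  shows "(\<Sum>i\<in>I. f i) *v x = (\<Sum>i\<in>I. f i *v x)"
  by (induction I rule: infinite_finite_induct) (auto simp: matrix_vector_mult_add_rdistrib)

text \<open>Only the square of \<open>z\<close> is estimated. The cross term stays exact: it is
  linear in \<open>z\<close>, so it can be averaged later.\<close>

lemma norm_convex_combination_contraction_le:
  fixes y z :: "'a::real_inner"
  assumes "norm z \<le> norm y"
  shows "(norm ((1 - \<eta>) *\<^sub>R y + \<eta> *\<^sub>R z))\<^sup>2 \<le>
    ((1 - \<eta>)\<^sup>2 + \<eta>\<^sup>2) * (norm y)\<^sup>2 + 2 * \<eta> * (1 - \<eta>) * (y \<bullet> z)"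
proof -
  have "(norm ((1 - \<eta>) *\<^sub>R y + \<eta> *\<^sub>R z))\<^sup>2 =
    (1 - \<eta>)\<^sup>2 * (norm y)\<^sup>2 + 2 * \<eta> * (1 - \<eta>) * (y \<bullet> z) + \<eta>\<^sup>2 * (norm z)\<^sup>2"
    unfolding power2_norm_eq_inner
    by (simp add: inner_add_left inner_add_right inner_commute power2_eq_square algebra_simps)
  moreover have "\<eta>\<^sup>2 * (norm z)\<^sup>2 \<le> \<eta>\<^sup>2 * (norm y)\<^sup>2"
    using assms by (intro mult_left_mono power_mono) auto
  ultimately show ?thesis
    by (simp add: distrib_right)
qed

theorem theorem2:
  fixes M :: nat and u :: "nat \<Rightarrow> nat" and W :: "'n::nontriv sq_matrix" and \<rho> \<eta> :: real
  assumes "M \<ge> 1"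
    and "\<And>i. i \<in> {1..M} \<Longrightarrow> u i \<in> {1..CARD('n) - 1}"
    and "W = (1 / real M) *\<^sub>R (\<Sum>i\<in>{1..M}. basis_matrix (u i))"
    and "\<rho> = consensus_rate W"
    and "0 < \<eta>" and "\<eta> < 1"
  shows "\<forall>x :: real ^ 'n mod_ring.
    measure_pmf.expectation (map_pmf u (pmf_of_set {1..M}))
      (\<lambda>v. (norm (centering_matrix *v (od_equidyn_matrix \<eta> v *v x)))\<^sup>2)
    \<le> (1 - 2 * \<eta> * (1 - \<eta>) * (1 - \<rho>)) * (norm (centering_matrix *v x))\<^sup>2"
proof
  fix x :: "real ^ 'n mod_ring"
  define A :: "nat \<Rightarrow> 'n sq_matrix" where "A i = basis_matrix (u i)" for i
  have W_mult: "W *v z = (1 / real M) *\<^sub>R (\<Sum>i\<in>{1..M}. A i *v z)" for z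
    by (simp add: assms(3) A_def scaleR_matrix_vector_assoc[symmetric] sum_matrix_vector_mult)
  have contraction: "norm (A i *v z) \<le> norm z" if "i \<in> {1..M}" for i z
    unfolding A_def using assms(2)[OF that] by (rule norm_basis_matrix_le)
  have commute: "centering_matrix *v (A i *v z) = A i *v (centering_matrix *v z)"
    if "i \<in> {1..M}" for i z
    unfolding A_def using assms(2)[OF that] by (rule centering_basis_matrix)
  have W_commute: "centering_matrix *v (W *v z) = W *v (centering_matrix *v z)" for z
  proof -
    have "(\<Sum>i\<in>{1..M}. centering_matrix *v (A i *v z)) =
      (\<Sum>i\<in>{1..M}. A i *v (centering_matrix *v z))"
      by (rule sum.cong) (simp_all add: commute)
    then show ?thesis
      by (simp add: W_mult matrix_vector_mult_scaleR linear_sum[OF matrix_vector_mul_linear])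
  qed
  have W_contraction: "norm (W *v z) \<le> norm z" for z
  proof -
    have "norm (\<Sum>i\<in>{1..M}. A i *v z) \<le> real M * norm z"
      using sum_norm_le[of "{1..M}" "\<lambda>i. A i *v z" "\<lambda>_. norm z"] contraction by simp
    then show ?thesis
      using assms(1) by (simp add: W_mult pos_divide_le_eq mult.commute)
  qed

  define y where "y = centering_matrix *v x"
  let ?E = "measure_pmf.expectation (map_pmf u (pmf_of_set {1..M}))
      (\<lambda>v. (norm (centering_matrix *v (od_equidyn_matrix \<eta> v *v x)))\<^sup>2)"
  let ?a = "((1 - \<eta>)\<^sup>2 + \<eta>\<^sup>2) * (norm y)\<^sup>2" and ?b = "2 * \<eta> * (1 - \<eta>)"
  \<comment> \<open>Contraction and commutation make 1 an admissible bound, so the consensus rate is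
    attained.\<close>
  have "norm (W *v y) \<le> \<rho> * norm y"
    using consensus_rate_bound[of 1 W x] W_contraction
    by (simp add: W_commute y_def assms(4))
  then have inner_W: "y \<bullet> (W *v y) \<le> \<rho> * (norm y)\<^sup>2"
    using norm_cauchy_schwarz[of y "W *v y"]
      mult_left_mono[of "norm (W *v y)" "\<rho> * norm y" "norm y"]
    by (simp add: power2_eq_square mult.left_commute)

  \<comment> \<open>The expectation becomes an average over indices, not values, so repeated shifts
    count with multiplicity.\<close>
  have "?E = (\<Sum>i\<in>{1..M}. (norm ((1 - \<eta>) *\<^sub>R y + \<eta> *\<^sub>R (A i *v y)))\<^sup>2) / real M"
    using assms(1)
    by (auto simp: integral_pmf_of_set od_equidyn_matrix_def A_def[symmetric] commute y_def
        matrix_vector_mult_add_rdistrib scaleR_matrix_vector_assoc[symmetric]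
        matrix_vector_right_distrib matrix_vector_mult_scaleR intro!: sum.cong)
  also have "\<dots> \<le> (\<Sum>i\<in>{1..M}. ?a + ?b * (y \<bullet> (A i *v y))) / real M"
    by (intro divide_right_mono sum_mono norm_convex_combination_contraction_le contraction) auto
  also have "\<dots> = ?a + ?b * (y \<bullet> (W *v y))"
    using assms(1)
    by (simp add: W_mult sum.distrib sum_distrib_left[symmetric] inner_sum_right add_divide_distrib)
  also have "\<dots> \<le> ?a + ?b * (\<rho> * (norm y)\<^sup>2)"
    using inner_W assms(5,6) by (intro add_left_mono mult_left_mono) auto
  \<comment> \<open>Uses that \<open>(1 - \<eta>)\<^sup>2 + \<eta>\<^sup>2\<close> equals
    \<open>1 - 2 * \<eta> * (1 - \<eta>)\<close>.\<close>
  also have "\<dots> = (1 - 2 * \<eta> * (1 - \<eta>) * (1 - \<rho>)) * (norm y)\<^sup>2"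
    by (simp add: power2_eq_square algebra_simps)
  finally show "?E \<le> (1 - 2 * \<eta> * (1 - \<eta>) * (1 - \<rho>)) * (norm (centering_matrix *v x))\<^sup>2"
    by (simp add: y_def)
qed

end
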